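(* Let $h:\mathbb Z\times\mathbb Z_+\times\mathcal M\to\mathbb C$ be $\partial B$-determined and $(Y,M)$-harmonic. Then $$\sup_{(y,m)\in B\times\mathcal M}\frac{\left|\Re(h)(y,m)-\mathbb P_{(y,m)}(\tau<\infty)\right|}{\mathbb P_{(y,m)}(\tau<\infty)}\le c^*,\qquad c^*\doteq\sup_{y\in\partial B,\,m\in\mathcal M}|h(y,m)-1|,$$ where $\Re$ denotes the real part.
   Context: Setting: $\mathcal M$ is a finite set, $\bm P$ an irreducible aperiodic transition matrix on $\mathcal M$ with stationary distribution $\bm\pi$; for each $m\in\mathcal M$, $\lambda(m),\mu_1(m),\mu_2(m)>0$ and $\lambda(m)+\mu_1(m)+\mu_2(m)=1$; and $\sum_{m}(\lambda(m)-\mu_i(m))\bm\pi(m)\bm P(m,m)<0$ for $i=1,2$ (stability). $(Y,M)$ is the Markov chain on $\mathbb Z\times\mathbb Z_+\times\mathcal M$ which from $(y,m)$ moves to $(y,m')$ with probability $\bm P(m,m')$ for each $m'\neq m$, and with probability $\bm P(m,m)$ keeps $m$ and attempts an increment $v\in\{(-1,0),(1,1),(0,-1)\}$, chosen with respective probabilities $\lambda(m),\mu_1(m),\mu_2(m)$: it moves to $(y+v,m)$ if $y+v\in\mathbb Z\times\mathbb Z_+$ and otherwise stays. $h$ is $(Y,M)$-harmonic if $\mathbb E_{(y,m)}[h(Y_1,M_1)]=h(y,m)$ for all $(y,m)\in\mathbb Z\times\mathbb Z_+\times\mathcal M$. $B=\{y\in\mathbb Z\times\mathbb Z_+:y(1)\ge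 y(2)\}$, $\partial B=\{y\in\mathbb Z\times\mathbb Z_+:y(1)=y(2)\}$, $\tau=\inf\{k\ge0:Y_k\in\partial B\}$. A harmonic $h$ is $\partial B$-determined if for some function $f$, $h(y,m)=\mathbb E_{(y,m)}[f(Y_\tau,M_\tau)1_{\{\tau<\infty\}}]$ for all $(y,m)\in B\times\mathcal M$. *)

theory Defs
  imports "HOL-Probability.Probability"
begin

text \<open>The half plane \<open>\<int> \<times> \<int>\<^sub>+\<close> is the type \<^typ>\<open>int \<times> nat\<close>, and the finite set of modulating states
  is a type of class \<^class>\<open>finite\<close>.  A transition matrix is a map \<open>P :: 'm \<Rightarrow> 'm pmf\<close>, with
  entries \<open>P(m, m') = pmf (P m) m'\<close>.\<close>

type_synonym 'm state = "(int \<times> nat) \<times> 'm"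

primrec matrix_power :: "('m \<Rightarrow> 'm pmf) \<Rightarrow> nat \<Rightarrow> 'm \<Rightarrow> 'm pmf" where
  "matrix_power P 0 m = return_pmf m"
| "matrix_power P (Suc n) m = bind_pmf (P m) (matrix_power P n)"

definition irreducible_matrix :: "('m \<Rightarrow> 'm pmf) \<Rightarrow> bool" where
  "irreducible_matrix P \<longleftrightarrow> (\<forall>m m'. \<exists>n. pmf (matrix_power P n m) m' > 0)"

definition aperiodic_matrix :: "('m \<Rightarrow> 'm pmf) \<Rightarrow> bool" where
  "aperiodic_matrix P \<longleftrightarrow> (\<forall>m. Gcd {n. n > 0 \<and> pmf (matrix_power P n m) m > 0} = 1)"

definition stationary :: "('m \<Rightarrow> 'm pmf) \<Rightarrow> 'm pmf \<Rightarrow> bool" where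
  "stationary P \<pi> \<longleftrightarrow> bind_pmf \<pi> P = \<pi>"

definition increment :: "('m \<Rightarrow> real) \<Rightarrow> ('m \<Rightarrow> real) \<Rightarrow> ('m \<Rightarrow> real) \<Rightarrow> 'm \<Rightarrow> (int \<times> int) pmf" where
  "increment lam mu1 mu2 m =
     pmf_of_list [((-1, 0), lam m), ((1, 1), mu1 m), ((0, -1), mu2 m)]"

definition attempt :: "int \<times> nat \<Rightarrow> int \<times> int \<Rightarrow> int \<times> nat" where
  "attempt y v =
     (if int (snd y) + snd v \<ge> 0 then (fst y + fst v, nat (int (snd y) + snd v)) else y)"

definition walk_kernel ::
  "('m \<Rightarrow> 'm pmf) \<Rightarrow> ('m \<Rightarrow> real) \<Rightarrow> ('m \<Rightarrow> real) \<Rightarrow> ('m \<Rightarrow> real) \<Rightarrow> 'm state \<Rightarrow> 'm state pmf" where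
  "walk_kernel P lam mu1 mu2 = (\<lambda>(y, m).
     bind_pmf (P m) (\<lambda>m'.
       if m' \<noteq> m then return_pmf (y, m')
       else map_pmf (\<lambda>v. (attempt y v, m)) (increment lam mu1 mu2 m)))"

definition chain_step :: "('s \<Rightarrow> 's pmf) \<Rightarrow> 's \<Rightarrow> nat \<Rightarrow> (nat \<Rightarrow> 's) \<Rightarrow> 's measure" where
  "chain_step K x n \<omega> = (case n of 0 \<Rightarrow> measure_pmf (return_pmf x) | Suc k \<Rightarrow> measure_pmf (K (\<omega> k)))"

text \<open>\<open>path_measure K x\<close> is the Ionescu-Tulcea measure on \<open>nat \<Rightarrow> 's\<close> of the Markov chain with kernel
  \<open>K\<close> started at \<open>x\<close>; \<open>\<omega> k\<close> is the position at time \<open>k\<close>.\<close>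

definition path_measure :: "('s \<Rightarrow> 's pmf) \<Rightarrow> 's \<Rightarrow> (nat \<Rightarrow> 's) measure" where
  "path_measure K x =
     projective_family.lim UNIV (Ionescu_Tulcea.CI (chain_step K x) (\<lambda>_. count_space UNIV))
       (\<lambda>_. count_space UNIV)"

lemma Ionescu_Tulcea_chain_step:
  fixes K :: "'s::countable \<Rightarrow> 's pmf"
  shows "Ionescu_Tulcea (chain_step K x) (\<lambda>_. count_space UNIV)"
proof (rule Ionescu_Tulcea.intro)
  fix n :: nat
  show "chain_step K x n \<in> measurable (PiM {0..<n} (\<lambda>_. count_space UNIV)) (subprob_algebra (count_space UNIV))"
  proof (cases n)
    case 0
    then show ?thesis
      by (auto simp: chain_step_def[abs_def] intro!: measurable_const measure_pmf_in_subprob_algebra)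
  next
    case (Suc k)
    have 1: "(\<lambda>\<omega>. \<omega> k) \<in> measurable (PiM {0..<n} (\<lambda>_. count_space UNIV)) (count_space (UNIV::'s set))"
      using Suc by (intro measurable_component_singleton) auto
    have 2: "(\<lambda>s. measure_pmf (K s)) \<in> measurable (count_space UNIV) (subprob_algebra (count_space UNIV))"
      by (auto intro!: measure_pmf_in_subprob_algebra)
    show ?thesis
      using measurable_compose[OF 1 2] Suc by (simp add: chain_step_def[abs_def])
  qed
next
  fix n :: nat and \<omega> :: "nat \<Rightarrow> 's"
  show "prob_space (chain_step K x n \<omega>)"
    by (cases n) (simp_all add: chain_step_def measure_pmf.prob_space_axioms)
qed

lemma sets_path_measure:
  "sets (path_measure K x :: (nat \<Rightarrow> 's::countable) measure) = sets (PiM UNIV (\<lambda>_. count_space UNIV))"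
proof -
  interpret Ionescu_Tulcea "chain_step K x" "\<lambda>_. count_space UNIV"
    by (rule Ionescu_Tulcea_chain_step)
  show ?thesis unfolding path_measure_def by simp
qed

lemma space_path_measure: "space (path_measure K x :: (nat \<Rightarrow> 's::countable) measure) = UNIV"
  using sets_eq_imp_space_eq[OF sets_path_measure[of K x]] by (simp add: space_PiM)

lemma prob_space_path_measure: "prob_space (path_measure K x :: (nat \<Rightarrow> 's::countable) measure)"
proof -
  interpret Ionescu_Tulcea "chain_step K x" "\<lambda>_. count_space UNIV"
    by (rule Ionescu_Tulcea_chain_step)
  interpret C0: prob_space "CI {}" by (rule PF.prob_space_P) auto
  have "emeasure PF.lim (PF.emb UNIV {} {\<lambda>_. undefined}) = emeasure (CI {}) {\<lambda>_. undefined}"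
    by (rule lim) (auto simp: sets_PiM_empty)
  also have "\<dots> = 1"
    using C0.emeasure_space_1 PF.space_P[of "{}"] by (simp add: space_PiM)
  finally have "emeasure PF.lim UNIV = 1"
    by (simp add: prod_emb_def space_PiM restrict_def vimage_def)
  then show ?thesis
    using space_path_measure[of K x] by (intro prob_spaceI) (simp add: path_measure_def)
qed

lemma emeasure_path_measure_cylinder:
  fixes K :: "'s::countable \<Rightarrow> 's pmf"
  shows "emeasure (path_measure K x) {\<omega>. \<forall>i\<le>n. \<omega> i = w i}
    = ennreal (indicator {x} (w 0) * (\<Prod>i<n. pmf (K (w i)) (w (Suc i))))"
proof -
  interpret Ionescu_Tulcea "chain_step K x" "\<lambda>_. count_space UNIV"
    by (rule Ionescu_Tulcea_chain_step)
  let ?M = "\<lambda>_::nat. count_space (UNIV::'s set)"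
  define W where "W n = PiE {0..<n} (\<lambda>i. {w i})" for n
  have W[measurable]: "W n \<in> sets (PiM {0..<n} ?M)" for n
    unfolding W_def by (intro sets_PiM_I_finite) auto
  have sp: "space (PiM {0..<n} ?M) = PiE {0..<n} (\<lambda>_. UNIV)" for n
    by (simp add: space_PiM)
  have u: "(\<lambda>_. undefined) \<in> space (PiM {0..<0} ?M)" by (simp add: sp)
  have sC: "space (C 0 k (\<lambda>_. undefined)) = PiE {0..<k} (\<lambda>_. UNIV)"
    and setsC: "sets (C 0 k (\<lambda>_. undefined)) = sets (PiM {0..<k} ?M)" for k
    using space_C[OF u, of k] sets_C[OF u, of k] sp by simp_all
  have W_Suc: "fun_upd \<omega> k z \<in> W (Suc k) \<longleftrightarrow> \<omega> \<in> W k \<and> z = w k"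
    if "\<omega> \<in> PiE {0..<k} (\<lambda>_. UNIV)" for \<omega> k z
    using that by (auto simp: W_def PiE_iff extensional_def fun_upd_apply split: if_splits)
  have "emeasure (C 0 (Suc k) (\<lambda>_. undefined)) (W (Suc k))
      = emeasure (C 0 k (\<lambda>_. undefined)) (W k) * emeasure (chain_step K x k w) {w k}" for k
  proof -
    have "emeasure (C 0 (Suc k) (\<lambda>_. undefined)) (W (Suc k))
        = (\<integral>\<^sup>+ \<omega>. emeasure (eP k \<omega>) (W (Suc k)) \<partial>C 0 k (\<lambda>_. undefined))"
      using measurable_eP[of k] sC[of k] setsC[of k] W[of "Suc k"]
      by (auto intro!: emeasure_bind[where N="PiM {0..<Suc k} ?M"] cong: measurable_cong_sets)
    also have "\<dots> = (\<integral>\<^sup>+ \<omega>. emeasure (chain_step K x k w) {w k} * indicator (W k) \<omega> \<partial>C 0 k (\<lambda>_. undefined))"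
    proof (intro nn_integral_cong)
      fix \<omega> assume "\<omega> \<in> space (C 0 k (\<lambda>_. undefined))"
      then have om: "\<omega> \<in> PiE {0..<k} (\<lambda>_. UNIV)" by (simp add: sC)
      have "emeasure (eP k \<omega>) (W (Suc k)) = emeasure (chain_step K x k \<omega>) {z. fun_upd \<omega> k z \<in> W (Suc k)}"
        using emeasure_eP[of \<omega> k "W (Suc k)"] om W[of "Suc k"] by (simp add: sp vimage_def)
      also have "{z. fun_upd \<omega> k z \<in> W (Suc k)} = (if \<omega> \<in> W k then {w k} else {})"
        using W_Suc[OF om] by auto
      also have "emeasure (chain_step K x k \<omega>) (if \<omega> \<in> W k then {w k} else {})
          = emeasure (chain_step K x k w) {w k} * indicator (W k) \<omega>"
        by (cases k) (auto simp: chain_step_def W_def PiE_iff)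
      finally show "emeasure (eP k \<omega>) (W (Suc k)) = emeasure (chain_step K x k w) {w k} * indicator (W k) \<omega>" .
    qed
    also have "\<dots> = emeasure (chain_step K x k w) {w k} * emeasure (C 0 k (\<lambda>_. undefined)) (W k)"
      using W[of k] setsC[of k] by (intro nn_integral_cmult_indicator) simp
    finally show ?thesis by (simp add: mult.commute)
  qed
  note rec = this
  have "emeasure (C 0 (Suc n) (\<lambda>_. undefined)) (W (Suc n))
      = ennreal (indicator {x} (w 0) * (\<Prod>i<n. pmf (K (w i)) (w (Suc i))))"
  proof (induction n)
    case 0
    have "emeasure (C 0 0 (\<lambda>_. undefined)) (W 0) = 1"
      using W[of 0] by (simp add: W_def)
    moreover have "emeasure (chain_step K x 0 w) {w 0} = ennreal (indicator {x} (w 0))"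
      by (simp add: chain_step_def emeasure_pmf_single indicator_def)
    ultimately show ?case
      unfolding rec[of 0] by simp
  next
    case (Suc n)
    show ?case
      unfolding rec[of "Suc n"] Suc
      by (simp add: chain_step_def emeasure_pmf_single ennreal_mult'[symmetric] prod_nonneg mult.assoc)
  qed
  moreover have "{\<omega>. \<forall>i\<le>n. \<omega> i = w i} = PF.emb UNIV {0..<Suc n} (W (Suc n))"
    by (auto simp: prod_emb_def W_def space_PiM PiE_iff less_Suc_eq_le)
  moreover have "emeasure PF.lim (PF.emb UNIV {0..<Suc n} (W (Suc n))) = emeasure (CI {0..<Suc n}) (W (Suc n))"
    using W by (intro lim) auto
  moreover have "emeasure (CI {0..<Suc n}) (W (Suc n)) = emeasure (C 0 (Suc n) (\<lambda>_. undefined)) (W (Suc n))"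
    using emeasure_CI[of "{0..<Suc n}" "Suc n" "W (Suc n)"] W sets.sets_into_space[OF W[of "Suc n"]] 
    by (simp add: prod_emb_id space_PiM)
  ultimately show ?thesis unfolding path_measure_def by simp
qed

text \<open>For a kernel with finitely supported rows, such as \<^const>\<open>walk_kernel\<close>, \<open>h (\<omega> 1)\<close> takes only finitely many values
  almost surely, so integrability need not be demanded here.\<close>

definition harmonic :: "('s \<Rightarrow> 's pmf) \<Rightarrow> ('s \<Rightarrow> complex) \<Rightarrow> bool" where
  "harmonic K h \<longleftrightarrow> (\<forall>x. (LINT \<omega>|path_measure K x. h (\<omega> 1)) = h x)"

definition B :: "(int \<times> nat) set" where
  "B = {y. fst y \<ge> int (snd y)}"

definition bdB :: "(int \<times> nat) set" where
  "bdB = {y. fst y = int (snd y)}"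

definition tau :: "(nat \<Rightarrow> 'm state) \<Rightarrow> enat" where
  "tau \<omega> = Inf {enat k |k. fst (\<omega> k) \<in> bdB}"

definition prob_hit :: "('m state \<Rightarrow> 'm state pmf) \<Rightarrow> 'm state \<Rightarrow> real" where
  "prob_hit K x = measure (path_measure K x) {\<omega> \<in> space (path_measure K x). tau \<omega> < \<infinity>}"

definition boundary_value :: "('m state \<Rightarrow> complex) \<Rightarrow> (nat \<Rightarrow> 'm state) \<Rightarrow> complex" where
  "boundary_value f \<omega> = (if tau \<omega> < \<infinity> then f (\<omega> (the_enat (tau \<omega>))) else 0)"

text \<open>The Bochner integral is \<open>0\<close> on functions that are not integrable, so the existence of the
  expectation is required explicitly.\<close>

definition bdB_determined :: "('m state \<Rightarrow> 'm state pmf) \<Rightarrow> ('m state \<Rightarrow> complex) \<Rightarrow> bool" where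
  "bdB_determined K h \<longleftrightarrow>
     (\<exists>f. \<forall>y\<in>B. \<forall>m.
        integrable (path_measure K (y, m)) (boundary_value f) \<and>
        h (y, m) = (LINT \<omega>|path_measure K (y, m). boundary_value f \<omega>))"

end

theory Submission
  imports Defs
begin

text \<open>The integral representation on the boundary, where \<open>\<tau> = 0\<close>, forces \<open>f = h\<close> there. Hence
  \<open>Re h(x) - P\<^sub>x(\<tau> < \<infinity>)\<close> is the expectation of \<open>Re h - 1\<close> at the hitting point, restricted to
  \<open>\<tau> < \<infinity>\<close>, and the integrand is at most \<open>c\<^sup>*\<close> times the indicator of \<open>\<tau> < \<infinity>\<close>.\<close>

text \<open>The cylinder fixing only time \<open>0\<close> at \<open>x\<close> carries an empty
  product of transition probabilities, hence mass \<open>1\<close>.\<close>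

lemma AE_path_measure_start:
  fixes K :: "'s::countable \<Rightarrow> 's pmf"
  shows "AE \<omega> in path_measure K x. \<omega> 0 = x"
proof -
  interpret prob_space "path_measure K x" by (rule prob_space_path_measure)
  have "emeasure (path_measure K x) {\<omega>. \<omega> 0 = x} = 1"
    using emeasure_path_measure_cylinder[of K x 0 "\<lambda>_. x"] by simp
  then have "prob {\<omega>. \<omega> 0 = x} = 1" by (simp add: measure_def)
  from AE_prob_1[OF this] show ?thesis by simp
qed

lemma tau_finite_iff: "tau \<omega> < \<infinity> \<longleftrightarrow> (\<exists>k. fst (\<omega> k) \<in> bdB)"
proof
  assume "tau \<omega> < \<infinity>"
  then show "\<exists>k. fst (\<omega> k) \<in> bdB"
    unfolding tau_def Inf_less_iff by blast
next
  assume "\<exists>k. fst (\<omega> k) \<in> bdB"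
  then obtain k where "fst (\<omega> k) \<in> bdB" ..
  then have "tau \<omega> \<le> enat k" unfolding tau_def by (intro Inf_lower) auto
  then show "tau \<omega> < \<infinity>" by (rule le_less_trans) simp
qed

text \<open>A nonempty set of extended naturals contains its infimum, so a finite \<open>tau\<close>
  is itself one of the hitting times.\<close>

lemma tau_hits:
  assumes "tau \<omega> < \<infinity>"
  shows "fst (\<omega> (the_enat (tau \<omega>))) \<in> bdB"
proof -
  have "{enat k |k. fst (\<omega> k) \<in> bdB} \<noteq> {}"
    using assms[unfolded tau_finite_iff] by blast
  then have "tau \<omega> \<in> {enat k |k. fst (\<omega> k) \<in> bdB}"
    unfolding tau_def Inf_enat_def by (auto intro: LeastI)
  then obtain k where "tau \<omega> = enat k" "fst (\<omega> k) \<in> bdB" by blast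
  then show ?thesis by simp
qed

lemma tau_eq_0:
  assumes "fst (\<omega> 0) \<in> bdB"
  shows "tau \<omega> = 0"
proof -
  have "tau \<omega> \<le> enat 0" unfolding tau_def using assms by (intro Inf_lower) auto
  then show ?thesis by (simp add: zero_enat_def[symmetric])
qed

text \<open>The event is a countable union of events on single coordinates, each measurable because
  the state space is discrete.\<close>

lemma sets_tau_finite:
  fixes K :: "'m::countable state \<Rightarrow> 'm state pmf"
  shows "{\<omega>. tau \<omega> < \<infinity>} \<in> sets (path_measure K x)"
proof -
  have "Measurable.pred (PiM (UNIV :: nat set) (\<lambda>_. count_space (UNIV :: 'm state set))) 
      (\<lambda>\<omega>. \<exists>k. fst (\<omega> k) \<in> bdB)"
    by measurable
  then show ?thesis
    unfolding tau_finite_iff sets_path_measure pred_def by (simp add: space_PiM)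
qed

lemma boundary_value_integral_on_bdB:
  fixes K :: "'m::countable state \<Rightarrow> 'm state pmf"
  assumes x: "fst x \<in> bdB"
    and int: "integrable (path_measure K x) (boundary_value f)"
  shows "(LINT \<omega>|path_measure K x. boundary_value f \<omega>) = f x"
proof -
  interpret prob_space "path_measure K x" by (rule prob_space_path_measure)
  have "(LINT \<omega>|path_measure K x. boundary_value f \<omega>) = (LINT \<omega>|path_measure K x. f x)"
  proof (rule integral_cong_AE)
    show "AE \<omega> in path_measure K x. boundary_value f \<omega> = f x"
      using AE_path_measure_start[where K = K and x = x]
    proof eventually_elim
      case (elim \<omega>)
      with x tau_eq_0[of \<omega>] show ?case by (simp add: boundary_value_def zero_enat_def)
    qed
  \<comment> \<open>Integrability supplies the measurability of \<open>boundary_value f\<close> that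
    comparing integrals almost everywhere requires.\<close>
  qed (use int in auto)
  then show ?thesis by (simp add: prob_space)
qed

text \<open>The product form of the bound stays informative when the hitting probability is
  \<open>0\<close>. Only values of \<open>f\<close> on the diagonal enter, since a path is evaluated
  at its hitting point or contributes \<open>0\<close>.\<close>

lemma Re_boundary_integral_bound:
  fixes K :: "'m::countable state \<Rightarrow> 'm state pmf"
  assumes int: "integrable (path_measure K x) (boundary_value f)"
    and bound: "\<And>z. fst z \<in> bdB \<Longrightarrow> cmod (f z - 1) \<le> c"
  shows "\<bar>Re (LINT \<omega>|path_measure K x. boundary_value f \<omega>) - prob_hit K x\<bar> \<le> c * prob_hit K x"
proof -
  interpret prob_space "path_measure K x" by (rule prob_space_path_measure)
  let ?H = "{\<omega>. tau \<omega> < \<infinity>} :: (nat \<Rightarrow> 'm state) set"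
  have H: "integrable (path_measure K x) (indicator ?H :: _ \<Rightarrow> real)"
    using sets_tau_finite[of K x] by (simp add: integrable_indicator_iff less_top[symmetric])
  have hit: "prob_hit K x = (LINT \<omega>|path_measure K x. indicator ?H \<omega>)"
    by (simp add: prob_hit_def space_path_measure)
  \<comment> \<open>On \<open>?H\<close> this is |Re w| \<le> |w| for w = f - 1 at the hitting
    point; off \<open>?H\<close> both sides are \<open>0\<close>.\<close>
  have pointwise: "\<bar>Re (boundary_value f \<omega>) - indicator ?H \<omega>\<bar> \<le> c * indicator ?H \<omega>" for \<omega>
  proof (cases "tau \<omega> < \<infinity>")
    case True
    have "\<bar>Re (boundary_value f \<omega> - 1)\<bar> \<le> c"
      using order_trans[OF abs_Re_le_cmod bound[OF tau_hits[OF True]]] True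
      by (simp add: boundary_value_def)
    with True show ?thesis by simp
  qed (simp add: boundary_value_def)
  have "\<bar>LINT \<omega>|path_measure K x. Re (boundary_value f \<omega>) - indicator ?H \<omega>\<bar>
      \<le> (LINT \<omega>|path_measure K x. \<bar>Re (boundary_value f \<omega>) - indicator ?H \<omega>\<bar>)"
    by (rule integral_abs_bound)
  also have "\<dots> \<le> (LINT \<omega>|path_measure K x. c * indicator ?H \<omega>)"
    using H int by (intro integral_mono pointwise) auto
  finally show ?thesis
    using H int by (simp add: hit)
qed

theorem proposition8p2:
  fixes P :: "'m::finite \<Rightarrow> 'm pmf"
    and lam mu1 mu2 :: "'m \<Rightarrow> real"
    and \<pi> :: "'m pmf"
    and h :: "(int \<times> nat) \<times> 'm \<Rightarrow> complex"
  assumes "irreducible_matrix P" and "aperiodic_matrix P" and "stationary P \<pi>"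
    and "\<And>m. lam m > 0" and "\<And>m. mu1 m > 0" and "\<And>m. mu2 m > 0"
    and "\<And>m. lam m + mu1 m + mu2 m = 1"
    and "(\<Sum>m\<in>UNIV. (lam m - mu1 m) * pmf \<pi> m * pmf (P m) m) < 0"
    and "(\<Sum>m\<in>UNIV. (lam m - mu2 m) * pmf \<pi> m * pmf (P m) m) < 0"
    and "harmonic (walk_kernel P lam mu1 mu2) h"
    and "bdB_determined (walk_kernel P lam mu1 mu2) h"
  shows "(SUP x\<in>B \<times> UNIV.
            ereal (\<bar>Re (h x) - prob_hit (walk_kernel P lam mu1 mu2) x\<bar> / prob_hit (walk_kernel P lam mu1 mu2) x))
         \<le> (SUP x\<in>bdB \<times> UNIV. ereal (cmod (h x - 1)))"
proof (rule SUP_least)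
  let ?K = "walk_kernel P lam mu1 mu2"
  fix x :: "'m state"
  assume "x \<in> B \<times> UNIV"
  then have x: "fst x \<in> B" by auto
  obtain f where f: "\<And>x. fst x \<in> B \<Longrightarrow> integrable (path_measure ?K x) (boundary_value f)"
      "\<And>x. fst x \<in> B \<Longrightarrow> h x = (LINT \<omega>|path_measure ?K x. boundary_value f \<omega>)"
    using assms(11) unfolding bdB_determined_def by (metis prod.collapse)
  \<comment> \<open>The diagonal lies in \<open>B\<close>, so the representation of \<open>h\<close>
    is available at \<open>z\<close>.\<close>
  have hf: "h z = f z" if "fst z \<in> bdB" for z
    using that f boundary_value_integral_on_bdB[of z ?K f] by (simp add: B_def bdB_def)
  let ?c = "SUP x\<in>bdB \<times> UNIV. ereal (cmod (h x - 1))"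
  have upper: "ereal (cmod (h z - 1)) \<le> ?c" if "fst z \<in> bdB" for z
    using that by (intro SUP_upper) (auto simp: mem_Times_iff)
  \<comment> \<open>The origin witnesses that the supremum runs over a nonempty set; over the empty
    set it would be -\<infinity> in \<open>ereal\<close>.\<close>
  have "fst (((0, 0), undefined) :: 'm state) \<in> bdB" by (simp add: bdB_def)
  from upper[OF this] have nonneg: "0 \<le> ?c"
    by (rule order_trans[rotated]) simp
  \<comment> \<open>The supremum may be +\<infinity>, where the claim is trivial, and
    \<open>nonneg\<close> excludes -\<infinity>; only a finite value \<open>r\<close> calls for the
    integral bound.\<close>
  show "ereal (\<bar>Re (h x) - prob_hit ?K x\<bar> / prob_hit ?K x) \<le> ?c"
  proof (cases ?c)
    case (real r)
    have "\<bar>Re (h x) - prob_hit ?K x\<bar> \<le> r * prob_hit ?K x"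
      unfolding f(2)[OF x]
      using f(1)[OF x]
    proof (rule Re_boundary_integral_bound)
      show "cmod (f z - 1) \<le> r" if "fst z \<in> bdB" for z
        using upper[OF that] unfolding real by (simp add: hf[OF that])
    qed
    moreover have "0 \<le> prob_hit ?K x" "0 \<le> r"
      using nonneg unfolding real by (simp_all add: prob_hit_def)
    \<comment> \<open>If the hitting probability vanishes, the quotient is \<open>0\<close> by convention.\<close>
    ultimately show ?thesis
      unfolding real by (auto simp: divide_le_eq)
  qed (use nonneg in auto)
qed

end
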